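(* Let $N\ge 1$, and let $a_1,\dots,a_N,c_1,\dots,c_N$ be real numbers with $\sum_{j=1}^N a_j=\sum_{j=1}^N c_j$. Let $n\ge 1$ and let $k_1,\dots,k_n$ be arbitrary real numbers. Define finite sequences $x^{(m)}$ and $y^{(m)}$ of length $2^{m-1}N$ for $1\le m\le n$ recursively by $x^{(1)}=(a_1+k_1,\dots,a_N+k_1)$, $y^{(1)}=(c_1+k_1,\dots,c_N+k_1)$, and for $2\le m\le n$ and $1\le j\le 2^{m-2}N$: $x^{(m)}_j=x^{(m-1)}_j$, $x^{(m)}_{2^{m-2}N+j}=y^{(m-1)}_j+k_m$, $y^{(m)}_j=y^{(m-1)}_j$, $y^{(m)}_{2^{m-2}N+j}=x^{(m-1)}_j+k_m$. Write $x_i=x^{(n)}_i$, $y_i=y^{(n)}_i$ for $1\le i\le 2^{n-1}N$. Then for every $p$ with $1\le p\le n$: (i) $\displaystyle\sum_{i=1}^{2^{n-1}N}x_i^p=\sum_{i=1}^{2^{n-1}N}y_i^p$, and (ii) $\displaystyle\sum_{i=1}^{2^{p-1}N}x_i^p=\sum_{i=1}^{2^{p-1}N}y_i^p$.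
   Context: All numbers are real. By construction the first $2^{m-1}N$ entries of $x^{(n)}$ (resp. $y^{(n)}$) coincide with $x^{(m)}$ (resp. $y^{(m)}$) for $m\le n$. *)

theory Defs
  imports Complex_Main
begin

end

theory Submission
  imports Defs
begin

text \<open>
  If \<open>x\<close> and \<open>y\<close> have equal power sums in all degrees below \<open>p\<close>, then by the binomial theorem
  shifting both by \<open>k\<close> changes their power sums of degree \<open>p\<close> by the same amount. Hence
  appending \<open>y + k\<close> to \<open>x\<close> and \<open>x + k\<close> to \<open>y\<close> raises the degree up to which the power sums agree
  by one, as in the Prouhet--Tarry--Escott problem. Part (ii) is part (i) at level \<open>p\<close>, because
  later levels only extend the earlier ones.
\<close>

text \<open>The top binomial term is split off, so the correction caused by the shift depends on
  \<open>f\<close> only through its power sums of degree below \<open>p\<close>.\<close>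

lemma sum_power_shift:
  fixes f :: "'b \<Rightarrow> 'a::comm_ring_1"
  shows "(\<Sum>i\<in>A. (f i + k) ^ p) =
    (\<Sum>i\<in>A. f i ^ p) + (\<Sum>q<p. of_nat (p choose q) * k ^ (p - q) * (\<Sum>i\<in>A. f i ^ q))"
proof -
  have "(f i + k) ^ p = f i ^ p + (\<Sum>q<p. of_nat (p choose q) * k ^ (p - q) * f i ^ q)" for i
    unfolding binomial_ring lessThan_Suc_atMost [symmetric] by (simp add: ac_simps)
  then have "(\<Sum>i\<in>A. (f i + k) ^ p) =
      (\<Sum>i\<in>A. f i ^ p) + (\<Sum>i\<in>A. \<Sum>q<p. of_nat (p choose q) * k ^ (p - q) * f i ^ q)"
    by (simp add: sum.distrib)
  also have "(\<Sum>i\<in>A. \<Sum>q<p. of_nat (p choose q) * k ^ (p - q) * f i ^ q) =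
      (\<Sum>q<p. of_nat (p choose q) * k ^ (p - q) * (\<Sum>i\<in>A. f i ^ q))"
    by (subst sum.swap) (simp add: sum_distrib_left)
  finally show ?thesis .
qed

text \<open>Both sides equal the unshifted degree-\<open>p\<close> sums of \<open>f\<close> and
  \<open>g\<close> plus a common correction. Nothing is assumed in degree \<open>p\<close> itself,
  and this is where one degree is gained.\<close>

lemma sum_power_swap_shift:
  fixes f g :: "'b \<Rightarrow> 'a::comm_ring_1"
  assumes "\<And>q. q < p \<Longrightarrow> (\<Sum>i\<in>A. f i ^ q) = (\<Sum>i\<in>A. g i ^ q)"
  shows "(\<Sum>i\<in>A. f i ^ p) + (\<Sum>i\<in>A. (g i + k) ^ p) =
    (\<Sum>i\<in>A. g i ^ p) + (\<Sum>i\<in>A. (f i + k) ^ p)"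
  using assms by (simp add: sum_power_shift)

lemma sum_double_interval:
  fixes f :: "nat \<Rightarrow> 'a::comm_monoid_add"
  shows "(\<Sum>i=1..2 * L. f i) = (\<Sum>i=1..L. f i) + (\<Sum>i=1..L. f (L + i))"
proof -
  have "(\<Sum>i=1..L + L. f i) = (\<Sum>i=1..L. f i) + (\<Sum>i=L + 1..L + L. f i)"
    by (rule sum.ub_add_nat) simp
  also have "(\<Sum>i=L + 1..L + L. f i) = (\<Sum>i=1..L. f (L + i))"
    using sum.shift_bounds_cl_nat_ivl [of f 1 L L] by (simp add: add.commute)
  finally show ?thesis
    by (simp add: mult_2)
qed

text \<open>Stated for a generic \<open>z\<close> so that it serves both \<open>x\<close> and
  \<open>y\<close>.\<close>

lemma doubling_prefix:
  fixes N n :: nat and z :: "nat \<Rightarrow> nat \<Rightarrow> 'a"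
  assumes low: "\<And>m j. m \<in> {2..n} \<Longrightarrow> j \<in> {1..2 ^ (m - 2) * N} \<Longrightarrow> z m j = z (m - 1) j"
    and "1 \<le> m" "m \<le> n" and j: "j \<in> {1..2 ^ (m - 1) * N}"
  shows "z n j = z m j"
proof -
  have "m' \<le> n \<Longrightarrow> z m' j = z m j" if "m \<le> m'" for m'
    using that
  proof (induction m' rule: dec_induct)
    case base
    show ?case by simp
  next
    case (step r)
    \<comment> \<open>Since \<open>Suc r - 2 = r - 1\<close> and \<open>m \<le> r\<close>, the index
      \<open>j\<close> lies in the lower half of level \<open>Suc r\<close>, where entries are
      copied.\<close>
    have "2 ^ (m - 1) * N \<le> 2 ^ (Suc r - 2) * N"
      using step.hyps by (intro mult_right_mono power_increasing) auto
    then have "j \<in> {1..2 ^ (Suc r - 2) * N}"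
      using j unfolding atLeastAtMost_iff by (blast intro: order_trans)
    then have "z (Suc r) j = z r j"
      using low [of "Suc r" j] step.hyps step.prems \<open>1 \<le> m\<close> by simp
    then show ?case
      using step by simp
  qed
  then show ?thesis
    using \<open>m \<le> n\<close> by blast
qed

theorem theorem3:
  fixes N n :: nat
    and a c k :: "nat \<Rightarrow> real"
    and x y :: "nat \<Rightarrow> nat \<Rightarrow> real"
  assumes N: "N \<ge> 1"
    and n: "n \<ge> 1"
    and sum_eq: "(\<Sum>j=1..N. a j) = (\<Sum>j=1..N. c j)"
    and x_init: "\<And>j. j \<in> {1..N} \<Longrightarrow> x 1 j = a j + k 1"
    and y_init: "\<And>j. j \<in> {1..N} \<Longrightarrow> y 1 j = c j + k 1"
    and x_low: "\<And>m j. m \<in> {2..n} \<Longrightarrow> j \<in> {1..2 ^ (m - 2) * N} \<Longrightarrow>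
                  x m j = x (m - 1) j"
    and x_high: "\<And>m j. m \<in> {2..n} \<Longrightarrow> j \<in> {1..2 ^ (m - 2) * N} \<Longrightarrow>
                  x m (2 ^ (m - 2) * N + j) = y (m - 1) j + k m"
    and y_low: "\<And>m j. m \<in> {2..n} \<Longrightarrow> j \<in> {1..2 ^ (m - 2) * N} \<Longrightarrow>
                  y m j = y (m - 1) j"
    and y_high: "\<And>m j. m \<in> {2..n} \<Longrightarrow> j \<in> {1..2 ^ (m - 2) * N} \<Longrightarrow>
                  y m (2 ^ (m - 2) * N + j) = x (m - 1) j + k m"
  shows "\<forall>p\<in>{1..n}.
           (\<Sum>i=1..2 ^ (n - 1) * N. x n i ^ p) = (\<Sum>i=1..2 ^ (n - 1) * N. y n i ^ p) \<and>
           (\<Sum>i=1..2 ^ (p - 1) * N. x n i ^ p) = (\<Sum>i=1..2 ^ (p - 1) * N. y n i ^ p)"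
proof -
  \<comment> \<open>Degree \<open>0\<close> is included because the binomial correction also
    contains the term \<open>q = 0\<close>.\<close>
  have level: "\<forall>p\<le>m. (\<Sum>i=1..2 ^ (m - 1) * N. x m i ^ p) = (\<Sum>i=1..2 ^ (m - 1) * N. y m i ^ p)"
    if "1 \<le> m" "m \<le> n" for m
    using that
  proof (induction m rule: dec_induct)
    case base
    have "(\<Sum>i=1..N. x 1 i) = (\<Sum>i=1..N. y 1 i)"
      using sum_eq x_init y_init by (simp add: sum.distrib)
    then show ?case
      \<comment> \<open>Only \<open>p = 0\<close>, where both sums count the entries, and
        \<open>p = 1\<close> occur.\<close>
      by (auto simp: le_Suc_eq)
  next
    case (step m)
    define L where "L = 2 ^ (m - 1) * N"
    have L2: "2 ^ (Suc m - 1) * N = 2 * L"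
      using step.hyps by (cases m) (simp_all add: L_def)
    have idx: "Suc m \<in> {2..n}" "2 ^ (Suc m - 2) * N = L"
      using step.hyps step.prems by (auto simp: L_def numeral_2_eq_2)
    have IH: "(\<Sum>i=1..L. x m i ^ q) = (\<Sum>i=1..L. y m i ^ q)" if "q \<le> m" for q
      using step.IH step.prems that by (simp add: L_def)
    show ?case
    proof (intro allI impI)
      fix p
      assume "p \<le> Suc m"
      have "(\<Sum>i=1..2 * L. x (Suc m) i ^ p) =
          (\<Sum>i=1..L. x m i ^ p) + (\<Sum>i=1..L. (y m i + k (Suc m)) ^ p)"
        using x_low [OF idx(1)] x_high [OF idx(1)]
        unfolding sum_double_interval idx(2) by simp
      also have "\<dots> = (\<Sum>i=1..L. y m i ^ p) + (\<Sum>i=1..L. (x m i + k (Suc m)) ^ p)"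
        \<comment> \<open>Only degrees \<open>q < p\<close> are required, hence
          \<open>q \<le> m\<close>, so \<open>IH\<close> suffices even for the new degree
          \<open>p = Suc m\<close>.\<close>
        using \<open>p \<le> Suc m\<close> by (intro sum_power_swap_shift IH) simp
      also have "\<dots> = (\<Sum>i=1..2 * L. y (Suc m) i ^ p)"
        using y_low [OF idx(1)] y_high [OF idx(1)]
        unfolding sum_double_interval idx(2) by simp
      finally show "(\<Sum>i=1..2 ^ (Suc m - 1) * N. x (Suc m) i ^ p) =
          (\<Sum>i=1..2 ^ (Suc m - 1) * N. y (Suc m) i ^ p)"
        unfolding L2 .
    qed
  qed
  show ?thesis
  proof
    fix p
    assume p: "p \<in> {1..n}"
    have "x n i = x p i" "y n i = y p i" if "i \<in> {1..2 ^ (p - 1) * N}" for i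
      using p that doubling_prefix [of n N x p i, OF x_low]
        doubling_prefix [of n N y p i, OF y_low] by auto
    then show "(\<Sum>i=1..2 ^ (n - 1) * N. x n i ^ p) = (\<Sum>i=1..2 ^ (n - 1) * N. y n i ^ p) \<and>
        (\<Sum>i=1..2 ^ (p - 1) * N. x n i ^ p) = (\<Sum>i=1..2 ^ (p - 1) * N. y n i ^ p)"
      using level [of n] level [of p] n p by simp
  qed
qed

end
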